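(* There are absolute constants $c_1,c_2>0$ such that for all integers $m\ge 1$ and $k\ge 1$ there is an interval graph $G_{m,k}$ with $|V(G_{m,k})|\le c_1(m+k)$ and two reconfigurable independent sets $I$, $J$ of size $k$ in $G_{m,k}$ such that every reconfiguration sequence from $I$ to $J$ in $G_{m,k}$ has length at least $c_2\cdot k^2\cdot m$.
   Context: All graphs are finite and simple. A graph is an interval graph if its vertices can be associated with intervals on the real line so that two distinct vertices are adjacent if and only if the corresponding intervals intersect. For a graph $G$ and a positive integer $k$, the reconfiguration graph $R_k(G)$ has as vertices all independent sets of size $k$ in $G$; two such sets $I,J$ are adjacent in $R_k(G)$ whenever $I\triangle J=\{u,v\}$ with $uv\in E(G)$ (token sliding). Two independent sets of size $k$ are reconfigurable if they lie in the same connected component of $R_k(G)$. Given a path $(I_0,\ldots,I_M)$ in $R_k(G)$ with $I_0=I$, $I_M=J$, let $(u_i,v_i)$ be given by $I_{i-1}\setminus I_i=\{u_i\}$, $I_i\setminus I_{i-1}=\{v_i\}$; then $((u_1,v_1),\ldots,(u_M,v_M))$ is called a reconfiguration sequence from $I$ to $J$ in $G$, of length $M$. *)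

theory Defs
  imports "HOL-Analysis.Analysis" "Graph_Theory.Graph_Theory"
begin

(* Finite simple graphs are represented by pair_graph: a finite vertex set together with a
   finite, symmetric and irreflexive set of ordered pairs. *)

definition interval_graph :: "'a pair_pre_digraph \<Rightarrow> bool" where
  "interval_graph G \<longleftrightarrow> pair_graph G \<and>
     (\<exists>\<iota> :: 'a \<Rightarrow> real set.
        (\<forall>v \<in> pverts G. is_interval (\<iota> v) \<and> \<iota> v \<noteq> {}) \<and>
        (\<forall>u \<in> pverts G. \<forall>v \<in> pverts G.
           u \<noteq> v \<longrightarrow> ((u, v) \<in> parcs G \<longleftrightarrow> \<iota> u \<inter> \<iota> v \<noteq> {})))"

definition independent_set :: "'a pair_pre_digraph \<Rightarrow> 'a set \<Rightarrow> bool" where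
  "independent_set G S \<longleftrightarrow> S \<subseteq> pverts G \<and> (\<forall>u \<in> S. \<forall>v \<in> S. (u, v) \<notin> parcs G)"

definition k_independent_sets :: "'a pair_pre_digraph \<Rightarrow> nat \<Rightarrow> 'a set set" where
  "k_independent_sets G k = {S. independent_set G S \<and> finite S \<and> card S = k}"

definition reconf_graph :: "'a pair_pre_digraph \<Rightarrow> nat \<Rightarrow> 'a set pair_pre_digraph" where
  "reconf_graph G k = \<lparr>
     pverts = k_independent_sets G k,
     parcs = {(I, J). I \<in> k_independent_sets G k \<and> J \<in> k_independent_sets G k \<and>
                (\<exists>u v. sym_diff I J = {u, v} \<and> (u, v) \<in> parcs G)} \<rparr>"

(* The reconfiguration graph is symmetric whenever G is, so the strongly connected components
   collected by sccs_verts are its connected components. *)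
definition reconfigurable :: "'a pair_pre_digraph \<Rightarrow> nat \<Rightarrow> 'a set \<Rightarrow> 'a set \<Rightarrow> bool" where
  "reconfigurable G k I J \<longleftrightarrow>
     (\<exists>C \<in> pre_digraph.sccs_verts (with_proj (reconf_graph G k)). I \<in> C \<and> J \<in> C)"

(* Is is the list of independent sets I_0, ..., I_M and s the list of moves (u_1, v_1), ...,
   (u_M, v_M); moves are indexed from 0 here. Independent sets may be revisited, so a lower bound
   on the length of all these sequences applies in particular to those arising from paths with
   pairwise distinct vertices. *)
definition reconf_seq ::
    "'a pair_pre_digraph \<Rightarrow> nat \<Rightarrow> 'a set \<Rightarrow> 'a set \<Rightarrow> ('a \<times> 'a) list \<Rightarrow> bool" where
  "reconf_seq G k I J s \<longleftrightarrow>
     (\<exists>Is. vwalk Is (with_proj (reconf_graph G k)) \<and> hd Is = I \<and> last Is = J \<and>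
           length Is = Suc (length s) \<and>
           (\<forall>i < length s. Is ! i - Is ! Suc i = {fst (s ! i)} \<and>
                            Is ! Suc i - Is ! i = {snd (s ! i)}))"

lemma pair_graph_reconf_graph:
  assumes "pair_graph G"
  shows "pair_graph (reconf_graph G k)"
proof -
  interpret G: pair_graph G by fact
  have s: "\<And>u v. (u, v) \<in> parcs G \<Longrightarrow> (v, u) \<in> parcs G"
    using G.arcs_symmetric by blast
  have fin: "finite (k_independent_sets G k)"
    by (rule finite_subset[of _ "Pow (pverts G)"])
       (auto simp: k_independent_sets_def independent_set_def)
  have sub: "parcs (reconf_graph G k) \<subseteq> k_independent_sets G k \<times> k_independent_sets G k"
    by (auto simp: reconf_graph_def)
  show ?thesis
  proof
    show "finite (parcs (reconf_graph G k))"
      using finite_subset[OF sub] fin by blast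
    show "finite (pverts (reconf_graph G k))"
      using fin by (simp add: reconf_graph_def)
    show "symmetric (with_proj (reconf_graph G k))"
    proof -
      have "(J, I) \<in> parcs (reconf_graph G k)" if IJ: "(I, J) \<in> parcs (reconf_graph G k)" for I J
      proof -
        obtain u v where "sym_diff I J = {u, v}" "(u, v) \<in> parcs G"
          using IJ unfolding reconf_graph_def by fastforce
        then have "\<exists>u v. sym_diff J I = {u, v} \<and> (u, v) \<in> parcs G"
          by (metis Un_commute)
        then show ?thesis using IJ unfolding reconf_graph_def by simp
      qed
      then show ?thesis by (simp add: symmetric_def sym_def)
    qed
  next
    fix e assume "e \<in> parcs (reconf_graph G k)"
    then show "fst e \<noteq> snd e" by (auto simp: reconf_graph_def)
  qed (auto simp: reconf_graph_def)
qed

lemma reconfigurable_iff_reachable: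
  assumes "pair_graph G"
  shows "reconfigurable G k I J \<longleftrightarrow> I \<rightarrow>\<^sup>*\<^bsub>with_proj (reconf_graph G k)\<^esub> J"
proof -
  interpret R: pair_graph "reconf_graph G k"
    using assms by (rule pair_graph_reconf_graph)
  show ?thesis
  proof
    assume "reconfigurable G k I J"
    then obtain C where C: "C \<in> pre_digraph.sccs_verts (with_proj (reconf_graph G k))"
        "I \<in> C" "J \<in> C"
      unfolding reconfigurable_def by (elim bexE conjE)
    from C(1) have "\<forall>u \<in> C. \<forall>v \<in> C. u \<rightarrow>\<^sup>*\<^bsub>with_proj (reconf_graph G k)\<^esub> v"
      unfolding R.sccs_verts_def mem_Collect_eq by (elim conjE)
    from bspec[OF bspec[OF this C(2)] C(3)] show "I \<rightarrow>\<^sup>*\<^bsub>with_proj (reconf_graph G k)\<^esub> J"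
      .
  next
    assume r: "I \<rightarrow>\<^sup>*\<^bsub>with_proj (reconf_graph G k)\<^esub> J"
    define C where "C = {K. I \<rightarrow>\<^sup>*\<^bsub>with_proj (reconf_graph G k)\<^esub> K}"
    have "I \<in> pverts (reconf_graph G k)"
      using R.reachable_in_verts(1)[OF r] by simp
    then have "I \<in> C"
      unfolding C_def by simp
    have "J \<in> C"
      using r by (simp add: C_def)
    have "C \<in> pre_digraph.sccs_verts (with_proj (reconf_graph G k))"
      unfolding R.sccs_verts_def
    proof (intro CollectI conjI ballI allI impI)
      show "C \<noteq> {}" using \<open>I \<in> C\<close> by blast
    next
      fix K L assume "K \<in> C" "L \<in> C"
      then show "K \<rightarrow>\<^sup>*\<^bsub>with_proj (reconf_graph G k)\<^esub> L"
        unfolding C_def mem_Collect_eq by (metis R.reachable_trans R.symmetric_reachable')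
    next
      fix K L assume "K \<in> C" "L \<notin> C"
      then show "\<not> K \<rightarrow>\<^sup>*\<^bsub>with_proj (reconf_graph G k)\<^esub> L \<or>
                 \<not> L \<rightarrow>\<^sup>*\<^bsub>with_proj (reconf_graph G k)\<^esub> K"
        unfolding C_def mem_Collect_eq by (metis R.reachable_trans)
    qed
    then show "reconfigurable G k I J"
      unfolding reconfigurable_def using \<open>I \<in> C\<close> \<open>J \<in> C\<close> by (intro bexI conjI)
  qed
qed

end

theory Submission
  imports Defs
begin

text \<open>
  The k tokens live on a long path of unit intervals. Beyond each end of the path lie p disjoint
  point intervals (shelves), which can only be reached through long intervals overlapping most of
  the path. The i-th long interval on one side is usable only if all tokens remaining on the path
  are packed towards the opposite end, and its length is chosen so that they fit there only after
  enough tokens have been shelved on the opposite side. Hence tokens must be shelved alternately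
  right, left, right, left, ..., and between two consecutive shelvings all remaining tokens traverse
  about m path vertices. With p = k div 3 there are 2p + 1 traversals, each by at least k/3 tokens.
  The lower bound follows from a potential that changes by at most 1 in every move.
\<close>

section \<open>Counting in sets of naturals, and Lipschitz functions along walks\<close>

text \<open>Cut the range into \<open>n\<close> blocks of two consecutive numbers: elements at
  distance at least 2 fall into different blocks, so halving the offset from \<open>a\<close> is
  injective on \<open>A\<close>.\<close>

lemma card_no_consecutive_le:
  fixes A :: "nat set"
  assumes "A \<subseteq> {a..<a + 2 * n}" and "\<forall>x\<in>A. Suc x \<notin> A"
  shows "card A \<le> n"
proof -
  have "inj_on (\<lambda>x. (x - a) div 2) A"
  proof (rule linorder_inj_onI)
    fix x y assume xy: "x < y" "x \<in> A" "y \<in> A"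
    then have "y \<noteq> Suc x" "a \<le> x" using assms by auto
    with xy have "x - a + 2 \<le> y - a" by linarith
    then have "(x - a + 2) div 2 \<le> (y - a) div 2" by (rule div_le_mono)
    then show "(x - a) div 2 \<noteq> (y - a) div 2" by simp
  qed auto
  moreover have "(\<lambda>x. (x - a) div 2) ` A \<subseteq> {..<n}"
    using assms(1) by fastforce
  ultimately have "card A \<le> card {..<n}"
    by (intro card_inj_on_le) auto
  then show ?thesis by simp
qed

lemma finite_downward_closed_nat:
  fixes B :: "nat set"
  assumes "finite B" and "\<And>n. Suc n \<in> B \<Longrightarrow> n \<in> B"
  shows "B = {..<card B}"
proof -
  obtain n where n: "n \<notin> B" "\<And>i. i < n \<Longrightarrow> i \<in> B"
  proof (rule that[of "LEAST n. n \<notin> B"])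
    show "(LEAST n. n \<notin> B) \<notin> B"
      using ex_new_if_finite[OF infinite_UNIV_nat assms(1)] by (rule LeastI_ex)
  qed (use not_less_Least in blast)
  have "n + d \<notin> B" for d
    by (induction d) (use n assms(2) in auto)
  then have "B = {..<n}"
    using n(2) by (metis le_add_diff_inverse lessThan_iff not_le subsetI subset_antisym)
  then show ?thesis by simp
qed

text \<open>Turns a potential that rises by at most 1 per arc into a lower bound on the length of a
  walk.\<close>

lemma vwalk_Lipschitz:
  fixes f :: "'a \<Rightarrow> int"
  assumes "vwalk Is G" and "\<And>I J. (I, J) \<in> arcs_ends G \<Longrightarrow> f J \<le> f I + 1"
  shows "f (last Is) \<le> f (hd Is) + int (length Is - 1)"
  using assms(1)
proof (induction Is rule: vwalk_arcs.induct)
  case (3 x y xs)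
  then have "vwalk (y # xs) G" "(x, y) \<in> arcs_ends G"
    by (auto simp: vwalk_def)
  with 3 assms(2)[of x y] show ?case by auto
qed (auto simp: vwalk_def)

section \<open>The interval graph: path, shelves and long intervals\<close>

text \<open>Here \<open>p\<close> is the number of shelves on each side; the assumption keeps the
  capacities \<open>k - 2 * i - 1\<close> and \<open>k - 2 * i - 2\<close> nonnegative for every
  \<open>i < p\<close>.\<close>

locale shelf_graph =
  fixes m k p :: nat
  assumes shelves_le: "2 * p \<le> k"
begin

text \<open>The first and the last \<open>2 * k\<close> path vertices each have room for
  \<open>k\<close> packed tokens; the \<open>m\<close> vertices in between are those to be
  traversed.\<close>

definition X :: nat where "X = m + 4 * k"

lemma X_int: "int X = int m + 4 * int k"
  by (simp add: X_def)

text \<open>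
  The vertices are the natural numbers below \<open>X + 4 * p\<close>: first the path, then the right shelves, the
  right long intervals, the left shelves and the left long intervals, p each. Shelves are numbered
  from the outside inwards. Next to a token on the i-th right long interval only \<open>k - 2 * i - 1\<close>
  tokens fit on the path; next to one on the i-th left long interval only \<open>k - 2 * i - 2\<close>.
\<close>

definition lo :: "nat \<Rightarrow> int" where
  "lo v = (if v < X then int v
    else if v < X + p then int X + int p - int (v - X)
    else if v < X + 2 * p then 2 * (int k - 2 * int (v - (X + p)) - 1)
    else if v < X + 3 * p then int (v - (X + 2 * p)) - int p
    else int (v - (X + 3 * p)) - int p)"

definition hi :: "nat \<Rightarrow> int" where
  "hi v = (if v < X then int v + 1
    else if v < X + p then int X + int p - int (v - X)
    else if v < X + 2 * p then int X + int p - int (v - (X + p))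
    else if v < X + 3 * p then int (v - (X + 2 * p)) - int p
    else int X - 2 * (int k - 2 * int (v - (X + 3 * p)) - 2))"

definition G :: "nat pair_pre_digraph" where
  "G = \<lparr>pverts = {..<X + 4 * p},
        parcs = {(u, v). u < X + 4 * p \<and> v < X + 4 * p \<and> u \<noteq> v \<and> lo u \<le> hi v \<and> lo v \<le> hi u}\<rparr>"

abbreviation (input) right_shelf :: "nat \<Rightarrow> nat" where "right_shelf i \<equiv> X + i"
abbreviation (input) right_long :: "nat \<Rightarrow> nat" where "right_long i \<equiv> X + p + i"
abbreviation (input) left_shelf :: "nat \<Rightarrow> nat" where "left_shelf i \<equiv> X + 2 * p + i"
abbreviation (input) left_long :: "nat \<Rightarrow> nat" where "left_long i \<equiv> X + 3 * p + i"

lemma lo_hi_path: "x < X \<Longrightarrow> lo x = int x" "x < X \<Longrightarrow> hi x = int x + 1"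
  by (simp_all add: lo_def hi_def)

lemma lo_hi_right_shelf:
  assumes "i < p"
  shows "lo (right_shelf i) = int X + int p - int i" "hi (right_shelf i) = int X + int p - int i"
  using assms by (simp_all add: lo_def hi_def)

lemma lo_hi_right_long:
  assumes "i < p"
  shows "lo (right_long i) = 2 * (int k - 2 * int i - 1)"
    "hi (right_long i) = int X + int p - int i"
  using assms by (simp_all add: lo_def hi_def)

lemma lo_hi_left_shelf:
  assumes "i < p"
  shows "lo (left_shelf i) = int i - int p" "hi (left_shelf i) = int i - int p"
  using assms by (simp_all add: lo_def hi_def)

lemma lo_hi_left_long:
  assumes "i < p"
  shows "lo (left_long i) = int i - int p"
    "hi (left_long i) = int X - 2 * (int k - 2 * int i - 2)"
  using assms by (simp_all add: lo_def hi_def)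

lemmas lo_hi = lo_hi_path lo_hi_right_shelf lo_hi_right_long lo_hi_left_shelf lo_hi_left_long

lemma vertex_cases [consumes 1, case_names path right_shelf right_long left_shelf left_long]:
  assumes "v < X + 4 * p"
  obtains "v < X"
    | i where "i < p" "v = right_shelf i"
    | i where "i < p" "v = right_long i"
    | i where "i < p" "v = left_shelf i"
    | i where "i < p" "v = left_long i"
proof -
  consider "v < X" | "X \<le> v" "v < X + p" | "X + p \<le> v" "v < X + 2 * p"
    | "X + 2 * p \<le> v" "v < X + 3 * p" | "X + 3 * p \<le> v" "v < X + 4 * p"
    using assms by linarith
  then show thesis
  proof cases
    case 1 then show thesis using that(1) by blast
  next
    case 2 then show thesis using that(2)[of "v - X"] by force
  next
    case 3 then show thesis using that(3)[of "v - (X + p)"] by force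
  next
    case 4 then show thesis using that(4)[of "v - (X + 2 * p)"] by force
  next
    case 5 then show thesis using that(5)[of "v - (X + 3 * p)"] by force
  qed
qed

lemma lo_le_hi:
  assumes "v < X + 4 * p"
  shows "lo v \<le> hi v"
  using assms shelves_le by (cases rule: vertex_cases) (auto simp: lo_hi X_int)

lemma arc_iff:
  "(u, v) \<in> parcs G \<longleftrightarrow> u < X + 4 * p \<and> v < X + 4 * p \<and> u \<noteq> v \<and> lo u \<le> hi v \<and> lo v \<le> hi u"
  by (simp add: G_def)

lemma pair_graph_G: "pair_graph G"
proof
  show "finite (parcs G)"
    by (rule finite_subset[of _ "{..<X + 4 * p} \<times> {..<X + 4 * p}"]) (auto simp: G_def)
  show "symmetric (with_proj G)"
    by (auto simp: symmetric_def sym_def G_def)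
qed (auto simp: G_def)

lemma interval_graph_G: "interval_graph G"
  unfolding interval_graph_def
proof (intro conjI exI[of _ "\<lambda>v. {real_of_int (lo v)..real_of_int (hi v)}"] ballI impI)
  fix u v assume "u \<in> pverts G" "v \<in> pverts G" "u \<noteq> v"
  moreover from this have "lo u \<le> hi u" "lo v \<le> hi v"
    using lo_le_hi by (auto simp: G_def)
  ultimately show "(u, v) \<in> parcs G \<longleftrightarrow>
      {real_of_int (lo u)..real_of_int (hi u)} \<inter> {real_of_int (lo v)..real_of_int (hi v)} \<noteq> {}"
    by (auto simp: G_def)
next
  fix v assume "v \<in> pverts G"
  then show "{real_of_int (lo v)..real_of_int (hi v)} \<noteq> {}"
    using lo_le_hi by (auto simp: G_def)
qed (auto simp: pair_graph_G is_interval_cc)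

lemma k_independent_iff:
  "S \<in> k_independent_sets G k \<longleftrightarrow> S \<subseteq> {..<X + 4 * p} \<and> card S = k \<and>
     (\<forall>u\<in>S. \<forall>v\<in>S. u \<noteq> v \<longrightarrow> hi u < lo v \<or> hi v < lo u)"
proof -
  have "finite S" if "S \<subseteq> {..<X + 4 * p}"
    using that finite_subset by blast
  moreover have "(\<forall>u\<in>S. \<forall>v\<in>S. (u, v) \<notin> parcs G) \<longleftrightarrow>
      (\<forall>u\<in>S. \<forall>v\<in>S. u \<noteq> v \<longrightarrow> hi u < lo v \<or> hi v < lo u)" if "S \<subseteq> {..<X + 4 * p}"
    unfolding arc_iff using that by (meson lessThan_iff not_le subsetD)
  moreover have "pverts G = {..<X + 4 * p}" by (simp add: G_def)
  ultimately show ?thesis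
    unfolding k_independent_sets_def independent_set_def mem_Collect_eq by metis
qed

lemma separated:
  assumes "S \<in> k_independent_sets G k" "u \<in> S" "v \<in> S" "u \<noteq> v"
  shows "hi u < lo v \<or> hi v < lo u"
  using assms unfolding k_independent_iff by blast

section \<open>The potential, and the configurations with a token on a long interval\<close>

definition lam :: "nat set \<Rightarrow> nat" where "lam S = card (S \<inter> {X + 2 * p..<X + 3 * p})"

definition rho :: "nat set \<Rightarrow> nat" where "rho S = card (S \<inter> {X..<X + p})"

text \<open>Position clipped to the middle stretch: truncated subtraction gives 0 on the first
  \<open>2 * k\<close> path vertices, and the value is \<open>m\<close> on the last
  \<open>2 * k\<close>.\<close>

definition progress :: "nat \<Rightarrow> int" where "progress x = int (min m (x - 2 * k))"

text \<open>
  While \<open>rho S \<le> lam S\<close> the tokens on the path have to move left to allow the next shelving on the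
  right, otherwise they have to move right. Capping their contribution at \<open>width\<close> makes the potential
  insensitive to the position from which a token leaves the path: at that moment the other tokens
  alone contribute at least \<open>width\<close>.
\<close>

definition travelled :: "nat set \<Rightarrow> int" where
  "travelled S = (\<Sum>x\<in>S \<inter> {..<X}. progress x)"

definition remaining :: "nat set \<Rightarrow> int" where
  "remaining S = (\<Sum>x\<in>S \<inter> {..<X}. int m - progress x)"

definition width :: int where "width = int ((k - 2 * p) * m)"

text \<open>The multiple of \<open>width\<close> counts completed traversals. With \<open>j\<close>
  tokens shelved on each side there are \<open>2 * j\<close> of them; one more on the right makes
  \<open>2 * j + 1\<close>, which is \<open>2 * rho S - 1\<close>. The capped term measures the
  current traversal.\<close>

definition potential :: "nat set \<Rightarrow> int" where
  "potential S = (if rho S \<le> lam S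
     then 2 * int (lam S) * width +
       min width (remaining S)
     else (2 * int (rho S) - 1) * width +
       min width (travelled S))"

lemma progress_bounds: "0 \<le> progress x" "progress x \<le> int m"
  by (auto simp: progress_def)

lemma path_no_consecutive:
  assumes "S \<in> k_independent_sets G k"
  shows "\<forall>x\<in>S \<inter> {..<X}. Suc x \<notin> S \<inter> {..<X}"
proof (intro ballI notI)
  fix x assume "x \<in> S \<inter> {..<X}" "Suc x \<in> S \<inter> {..<X}"
  moreover from this have "hi x < lo (Suc x) \<or> hi (Suc x) < lo x"
    using assms by (auto simp: k_independent_iff)
  ultimately show False by (simp add: lo_hi)
qed

text \<open>Meant for \<open>z\<close> the only occupied long interval, so that every other token
  lies on the path or on a shelf.\<close>

lemma size_le_of_single_long:
  assumes "S \<in> k_independent_sets G k"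
    and sub: "S \<subseteq> insert z (S \<inter> {..<X} \<union> S \<inter> {X..<X + p} \<union> S \<inter> {X + 2 * p..<X + 3 * p})"
      (is "_ \<subseteq> insert z (?P \<union> ?R \<union> ?L)")
  shows "k \<le> Suc (card (S \<inter> {..<X}) + rho S + lam S)"
proof -
  have "card S \<le> card (insert z (?P \<union> ?R \<union> ?L))"
    by (rule card_mono[OF _ sub]) simp
  also have "\<dots> \<le> Suc (card (?P \<union> ?R \<union> ?L))"
    by (simp add: card_insert_if)
  finally show ?thesis
    using assms(1) card_Un_le[of "?P \<union> ?R" ?L] card_Un_le[of ?P ?R]
    by (simp add: k_independent_iff lam_def rho_def)
qed

text \<open>The long interval covers the right shelves from \<open>i\<close> on, so
  \<open>rho S \<le> i\<close>, and leaves room for at most \<open>k - 2 * i - 1\<close> tokens on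
  the path. Counting all \<open>k\<close> tokens gives \<open>2 * i \<le> rho S + lam S\<close>,
  hence \<open>rho S \<le> i \<le> lam S\<close>. The path tokens are squeezed into the first
  \<open>2 * k\<close> vertices, where \<open>progress\<close> vanishes.\<close>

lemma right_long_state:
  assumes S: "S \<in> k_independent_sets G k" and i: "i < p" "right_long i \<in> S"
  shows "rho S \<le> lam S" "travelled S = 0"
    "width \<le> remaining S"
proof -
  have V: "S \<subseteq> {..<X + 4 * p}"
    using S unfolding k_independent_iff by blast
  have sep: "hi v < 2 * (int k - 2 * int i - 1) \<or> int X + int p - int i < lo v"
    if "v \<in> S" "v \<noteq> right_long i" for v
    using separated[OF S that(1) i(2) that(2)] unfolding lo_hi_right_long[OF i(1)] .
  have path: "int x + 1 < 2 * (int k - 2 * int i - 1)" if "x \<in> S" "x < X" for x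
    using sep[of x] that i shelves_le by (simp add: lo_hi)
  \<comment> \<open>All long intervals contain the stretch from \<open>2 * k\<close> to
    \<open>m + 2 * k\<close>, so no two of them are occupied at once.\<close>
  have sub: "S \<subseteq> insert (right_long i)
      (S \<inter> {..<X} \<union> S \<inter> {X..<X + p} \<union> S \<inter> {X + 2 * p..<X + 3 * p})"
  proof
    fix v assume v: "v \<in> S"
    then have "v < X + 4 * p" using V by auto
    then show "v \<in> insert (right_long i)
      (S \<inter> {..<X} \<union> S \<inter> {X..<X + p} \<union> S \<inter> {X + 2 * p..<X + 3 * p})"
    proof (cases v rule: vertex_cases)
      case (right_long j)
      then show ?thesis using sep[OF v] shelves_le i by (auto simp: lo_hi X_int)
    next
      case (left_long j)
      then show ?thesis using sep[OF v] shelves_le i by (auto simp: lo_hi X_int)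
    qed (use v in auto)
  qed
  have tot: "k \<le> Suc (card (S \<inter> {..<X}) + rho S + lam S)"
    using size_le_of_single_long[OF S sub] .
  have "S \<inter> {X..<X + p} \<subseteq> {X..<X + i}"
  proof
    fix v assume "v \<in> S \<inter> {X..<X + p}"
    then obtain j where "v = right_shelf j" "j < p" "v \<in> S"
      by (metis IntE atLeastLessThan_iff le_iff_add nat_add_left_cancel_less)
    with sep[of v] shelves_le i show "v \<in> {X..<X + i}" by (auto simp: lo_hi X_int)
  qed
  from card_mono[OF _ this] have rho: "rho S \<le> i" by (simp add: rho_def)
  have "S \<inter> {..<X} \<subseteq> {0..<0 + 2 * (k - 2 * i - 1)}"
    using path by force
  then have q: "card (S \<inter> {..<X}) \<le> k - 2 * i - 1"
    using card_no_consecutive_le path_no_consecutive[OF S] by blast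
  have "card (S \<inter> {X + 2 * p..<X + 3 * p}) \<le> card {X + 2 * p..<X + 3 * p}"
    by (intro card_mono) auto
  then have lam: "lam S \<le> p" by (simp add: lam_def)
  show "rho S \<le> lam S" using tot rho q i shelves_le by linarith
  have low: "progress x = 0" if "x \<in> S \<inter> {..<X}" for x
    using path[of x] that by (auto simp: progress_def)
  then show "travelled S = 0" by (simp add: travelled_def)
  \<comment> \<open>Since \<open>rho S \<le> i < p\<close>, a right shelf is empty; this makes up
    for the token on the long interval.\<close>
  have "k - 2 * p \<le> card (S \<inter> {..<X})" using tot rho lam i by linarith
  then show "width \<le> remaining S"
    using low by (simp add: width_def remaining_def mult_right_mono)
qed

text \<open>Mirror image of \<open>right_long_state\<close>, with room for one token less on the
  path. Now the squeezed tokens have \<open>progress\<close> equal to \<open>m\<close>.\<close>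

lemma left_long_state:
  assumes S: "S \<in> k_independent_sets G k" and i: "i < p" "left_long i \<in> S"
  shows "lam S < rho S" "remaining S = 0"
    "width \<le> travelled S"
proof -
  have V: "S \<subseteq> {..<X + 4 * p}"
    using S unfolding k_independent_iff by blast
  have sep: "hi v < int i - int p \<or> int X - 2 * (int k - 2 * int i - 2) < lo v"
    if "v \<in> S" "v \<noteq> left_long i" for v
    using separated[OF S that(1) i(2) that(2)] unfolding lo_hi_left_long[OF i(1)] .
  have path: "int X - 2 * (int k - 2 * int i - 2) < int x" if "x \<in> S" "x < X" for x
    using sep[of x] that i shelves_le by (simp add: lo_hi X_int)
  have sub: "S \<subseteq> insert (left_long i)
      (S \<inter> {..<X} \<union> S \<inter> {X..<X + p} \<union> S \<inter> {X + 2 * p..<X + 3 * p})"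
  proof
    fix v assume v: "v \<in> S"
    then have "v < X + 4 * p" using V by auto
    then show "v \<in> insert (left_long i)
      (S \<inter> {..<X} \<union> S \<inter> {X..<X + p} \<union> S \<inter> {X + 2 * p..<X + 3 * p})"
    proof (cases v rule: vertex_cases)
      case (right_long j)
      then show ?thesis using sep[OF v] shelves_le i by (auto simp: lo_hi X_int)
    next
      case (left_long j)
      then show ?thesis using sep[OF v] shelves_le i by (auto simp: lo_hi X_int)
    qed (use v in auto)
  qed
  have tot: "k \<le> Suc (card (S \<inter> {..<X}) + rho S + lam S)"
    using size_le_of_single_long[OF S sub] .
  have "S \<inter> {X + 2 * p..<X + 3 * p} \<subseteq> {X + 2 * p..<X + 2 * p + i}"
  proof
    fix v assume v: "v \<in> S \<inter> {X + 2 * p..<X + 3 * p}"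
    then obtain j where j: "v = left_shelf j" by (auto simp: le_iff_add)
    with v have "j < p" "v \<in> S" by auto
    with j sep[of v] shelves_le i show "v \<in> {X + 2 * p..<X + 2 * p + i}"
      by (auto simp: lo_hi X_int)
  qed
  from card_mono[OF _ this] have lam: "lam S \<le> i" by (simp add: lam_def)
  have "S \<inter> {..<X} \<subseteq> {X - 2 * (k - 2 * i - 2)..<X - 2 * (k - 2 * i - 2) + 2 * (k - 2 * i - 2)}"
    using path i shelves_le by (force simp: X_def)
  then have q: "card (S \<inter> {..<X}) \<le> k - 2 * i - 2"
    using card_no_consecutive_le path_no_consecutive[OF S] by blast
  have "card (S \<inter> {X..<X + p}) \<le> card {X..<X + p}"
    by (intro card_mono) auto
  then have rho: "rho S \<le> p" by (simp add: rho_def)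
  \<comment> \<open>The smaller capacity gives \<open>2 * i + 1 \<le> rho S + lam S\<close>. With
    \<open>lam S \<le> i\<close> the inequality becomes strict, which forces the alternation of the
    two sides.\<close>
  show "lam S < rho S" using tot lam q i shelves_le by linarith
  have high: "progress x = int m" if "x \<in> S \<inter> {..<X}" for x
    using path[of x] that by (auto simp: progress_def X_def)
  then show "remaining S = 0" by (simp add: remaining_def)
  have "k - 2 * p \<le> card (S \<inter> {..<X})" using tot rho lam i by linarith
  then show "width \<le> travelled S"
    using high by (simp add: width_def travelled_def mult_right_mono)
qed

lemma width_nonneg: "0 \<le> width"
  by (simp add: width_def)

section \<open>Change of the potential under one slide\<close>

lemma insert_path:
  assumes "finite K" "x \<notin> K" "x < X"
  shows "lam (insert x K) = lam K" "rho (insert x K) = rho K"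
    "travelled (insert x K) = progress x + travelled K"
    "remaining (insert x K) = int m - progress x + remaining K"
  using assms by (simp_all add: lam_def rho_def travelled_def remaining_def)

lemma insert_right_shelf:
  assumes "finite K" "right_shelf i \<notin> K" "i < p"
  shows "lam (insert (right_shelf i) K) = lam K" "rho (insert (right_shelf i) K) = Suc (rho K)"
    "travelled (insert (right_shelf i) K) = travelled K"
    "remaining (insert (right_shelf i) K) = remaining K"
  using assms by (simp_all add: lam_def rho_def travelled_def remaining_def)

lemma insert_left_shelf:
  assumes "finite K" "left_shelf i \<notin> K" "i < p"
  shows "lam (insert (left_shelf i) K) = Suc (lam K)" "rho (insert (left_shelf i) K) = rho K"
    "travelled (insert (left_shelf i) K) = travelled K"
    "remaining (insert (left_shelf i) K) = remaining K"
  using assms by (simp_all add: lam_def rho_def travelled_def remaining_def)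

lemma insert_long:
  assumes "i < p" "z = right_long i \<or> z = left_long i"
  shows "lam (insert z K) = lam K" "rho (insert z K) = rho K"
    "travelled (insert z K) = travelled K" "remaining (insert z K) = remaining K"
    "potential (insert z K) = potential K"
  using assms by (auto simp: potential_def lam_def rho_def travelled_def remaining_def)

text \<open>The shelf counts agree, so both sets are in the same branch of \<open>potential\<close>;
  \<open>progress\<close> changes by at most 1, and capping at \<open>width\<close> does not enlarge
  differences.\<close>

lemma potential_path_path:
  assumes "finite K" "x \<notin> K" "y \<notin> K" "x < X" "y < X" "(x, y) \<in> parcs G"
  shows "\<bar>potential (insert x K) - potential (insert y K)\<bar> \<le> 1"
proof -
  have "x \<le> y + 1" "y \<le> x + 1"
    using assms by (simp_all add: arc_iff lo_hi)
  then have "\<bar>progress x - progress y\<bar> \<le> 1"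
    unfolding progress_def by linarith
  then show ?thesis
    using assms by (simp add: potential_def insert_path) linarith
qed

text \<open>By \<open>right_long_state\<close>, \<open>remaining K\<close> has already reached the
  cap, so the nonnegative contribution of \<open>x\<close> is cut off.\<close>

lemma potential_right_long_path:
  assumes "finite K" "x \<notin> K" "x < X" "i < p" "insert (right_long i) K \<in> k_independent_sets G k"
  shows "potential (insert x K) = potential (insert (right_long i) K)"
  using right_long_state[OF assms(5,4)] progress_bounds[of x] assms
  by (simp add: insert_long insert_path) (simp add: potential_def insert_path)

lemma potential_left_long_path:
  assumes "finite K" "x \<notin> K" "x < X" "i < p" "insert (left_long i) K \<in> k_independent_sets G k"
  shows "potential (insert x K) = potential (insert (left_long i) K)"
  using left_long_state[OF assms(5,4)] progress_bounds[of x] assms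
  by (simp add: insert_long insert_path) (simp add: potential_def insert_path)

text \<open>If \<open>rho K < lam K\<close>, the branch and its value stay the same. If
  \<open>rho K = lam K\<close>, the branch switches: a full traversal, worth \<open>width\<close>,
  moves from the capped term into the multiple of \<open>width\<close>, and the new capped term
  starts at \<open>travelled K = 0\<close>.\<close>

lemma potential_right_long_shelf:
  assumes "finite K" "right_shelf j \<notin> K" "j < p" "i < p"
    "insert (right_long i) K \<in> k_independent_sets G k"
  shows "potential (insert (right_shelf j) K) = potential (insert (right_long i) K)"
proof -
  have state: "rho K \<le> lam K" "travelled K = 0" "width \<le> remaining K"
    using right_long_state[OF assms(5,4)] assms(4) by (simp_all add: insert_long)
  then consider "Suc (rho K) \<le> lam K" | "rho K = lam K" by linarith
  then show ?thesis
    using state width_nonneg assms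
    by cases (simp_all add: insert_long potential_def insert_right_shelf ring_distribs)
qed

text \<open>The opposite switch, which occurs when \<open>rho K = Suc (lam K)\<close>; the new
  capped term starts at \<open>remaining K = 0\<close>.\<close>

lemma potential_left_long_shelf:
  assumes "finite K" "left_shelf j \<notin> K" "j < p" "i < p"
    "insert (left_long i) K \<in> k_independent_sets G k"
  shows "potential (insert (left_shelf j) K) = potential (insert (left_long i) K)"
proof -
  have state: "lam K < rho K" "remaining K = 0" "width \<le> travelled K"
    using left_long_state[OF assms(5,4)] assms(4) by (simp_all add: insert_long)
  then consider "Suc (lam K) < rho K" | "rho K = Suc (lam K)" by linarith
  then show ?thesis
    using state width_nonneg assms
    by cases (simp_all add: insert_long potential_def insert_left_shelf ring_distribs)
qed

text \<open>Shelves meet neither the path, nor each other, nor long intervals of the other side;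
  those cases contradict adjacency. Slides between long intervals leave the potential unchanged, and
  the other cases are the preceding lemmas.\<close>

lemma potential_slide:
  assumes S: "insert u K \<in> k_independent_sets G k" "insert v K \<in> k_independent_sets G k"
    and new: "finite K" "u \<notin> K" "v \<notin> K" and arc: "(u, v) \<in> parcs G"
  shows "\<bar>potential (insert u K) - potential (insert v K)\<bar> \<le> 1"
proof -
  have uv: "u < X + 4 * p" "v < X + 4 * p" "u \<noteq> v" "lo u \<le> hi v" "lo v \<le> hi u"
    using arc by (simp_all add: arc_iff)
  from uv(1) show ?thesis
  proof (cases u rule: vertex_cases)
    case path
    from uv(2) show ?thesis
    proof (cases v rule: vertex_cases)
      case path' : path
      then show ?thesis using potential_path_path new path arc by blast
    next
      case (right_shelf i)
      then show ?thesis using uv path by (simp add: lo_hi)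
    next
      case (right_long i)
      then show ?thesis using potential_right_long_path[of K u i] new path S by simp
    next
      case (left_shelf i)
      then show ?thesis using uv path by (simp add: lo_hi)
    next
      case (left_long i)
      then show ?thesis using potential_left_long_path[of K u i] new path S by simp
    qed
  next
    case u: (right_shelf j)
    from uv(2) show ?thesis
    proof (cases v rule: vertex_cases)
      case path
      then show ?thesis using uv u by (simp add: lo_hi)
    next
      case (right_shelf i)
      then show ?thesis using uv u by (simp add: lo_hi)
    next
      case (right_long i)
      then show ?thesis using potential_right_long_shelf[of K j i] new u S by simp
    next
      case (left_shelf i)
      then show ?thesis using uv u by (simp add: lo_hi)
    next
      case (left_long i)
      then show ?thesis using uv u shelves_le by (simp add: lo_hi)
    qed
  next
    case u: (right_long j)
    from uv(2) show ?thesis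
    proof (cases v rule: vertex_cases)
      case path
      then show ?thesis using potential_right_long_path[of K v j] new u S by simp
    next
      case (right_shelf i)
      then show ?thesis using potential_right_long_shelf[of K i j] new u S by simp
    next
      case (right_long i)
      then show ?thesis using u by (simp add: insert_long)
    next
      case (left_shelf i)
      then show ?thesis using uv u shelves_le by (simp add: lo_hi)
    next
      case (left_long i)
      then show ?thesis using u by (simp add: insert_long)
    qed
  next
    case u: (left_shelf j)
    from uv(2) show ?thesis
    proof (cases v rule: vertex_cases)
      case path
      then show ?thesis using uv u by (simp add: lo_hi)
    next
      case (right_shelf i)
      then show ?thesis using uv u by (simp add: lo_hi)
    next
      case (right_long i)
      then show ?thesis using uv u shelves_le by (simp add: lo_hi)
    next
      case (left_shelf i)
      then show ?thesis using uv u by (simp add: lo_hi)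
    next
      case (left_long i)
      then show ?thesis using potential_left_long_shelf[of K j i] new u S by simp
    qed
  next
    case u: (left_long j)
    from uv(2) show ?thesis
    proof (cases v rule: vertex_cases)
      case path
      then show ?thesis using potential_left_long_path[of K v j] new u S by simp
    next
      case (right_shelf i)
      then show ?thesis using uv u shelves_le by (simp add: lo_hi)
    next
      case (right_long i)
      then show ?thesis using u by (simp add: insert_long)
    next
      case (left_shelf i)
      then show ?thesis using potential_left_long_shelf[of K i j] new u S by simp
    next
      case (left_long i)
      then show ?thesis using u by (simp add: insert_long)
    qed
  qed
qed

lemma potential_step:
  assumes "(I, J) \<in> parcs (reconf_graph G k)"
  shows "potential J \<le> potential I + 1"
proof -
  obtain u v where I: "I \<in> k_independent_sets G k" and J: "J \<in> k_independent_sets G k"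
    and D: "sym_diff I J = {u, v}" and arc: "(u, v) \<in> parcs G"
    using assms unfolding reconf_graph_def by fastforce
  have fin: "finite I" "finite J" "card I = card J"
    using I J by (simp_all add: k_independent_sets_def)
  \<comment> \<open>Equal cardinalities put exactly one of the two differing vertices in each set,
    so the move is a slide over the common part.\<close>
  have "\<not> I \<subset> J" "\<not> J \<subset> I"
    using fin psubset_card_mono by (metis less_irrefl)+
  moreover have "I \<noteq> J" using D by auto
  ultimately have "I - J \<noteq> {}" "J - I \<noteq> {}" by auto
  then obtain x y where "x \<in> I - J" "y \<in> J - I" by blast
  moreover from this have "x \<noteq> y" "x \<in> {u, v}" "y \<in> {u, v}"
    unfolding D[symmetric] by blast+
  moreover from this have "sym_diff I J = {x, y}" unfolding D by blast
  ultimately have x: "I = insert x (I \<inter> J)" "x \<notin> I \<inter> J"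
    and y: "J = insert y (I \<inter> J)" "y \<notin> I \<inter> J" and xy: "(x, y) \<in> parcs G"
    using arc by (blast, blast, blast, blast, auto simp: arc_iff)
  have "\<bar>potential (insert x (I \<inter> J)) - potential (insert y (I \<inter> J))\<bar> \<le> 1"
    using potential_slide[of x "I \<inter> J" y] I J x y xy fin by simp
  then show ?thesis using x(1) y(1) by simp
qed

lemma length_reconf_seq_ge:
  assumes "reconf_seq G k I J s"
  shows "potential J - potential I \<le> int (length s)"
proof -
  obtain Is where Is: "vwalk Is (with_proj (reconf_graph G k))" "hd Is = I" "last Is = J"
    "length Is = Suc (length s)"
    using assms unfolding reconf_seq_def by blast
  have "potential (last Is) \<le> potential (hd Is) + int (length Is - 1)"
    by (rule vwalk_Lipschitz[OF Is(1)]) (auto intro: potential_step simp: arcs_ends_def arc_to_ends_def)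
  then show ?thesis using Is by simp
qed

section \<open>Reconfigurability of the two end configurations\<close>

abbreviation reach :: "nat set \<Rightarrow> nat set \<Rightarrow> bool" where
  "reach I J \<equiv> I \<rightarrow>\<^sup>*\<^bsub>with_proj (reconf_graph G k)\<^esub> J"

lemma reach_trans [trans]: "reach I J \<Longrightarrow> reach J K \<Longrightarrow> reach I K"
proof -
  interpret R: pair_graph "reconf_graph G k"
    using pair_graph_G by (rule pair_graph_reconf_graph)
  show "reach I J \<Longrightarrow> reach J K \<Longrightarrow> reach I K"
    by (rule R.reachable_trans)
qed

lemma reach_sym: "reach I J \<Longrightarrow> reach J I"
proof -
  interpret R: pair_graph "reconf_graph G k"
    using pair_graph_G by (rule pair_graph_reconf_graph)
  show "reach I J \<Longrightarrow> reach J I"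
    using R.symmetric_reachable' by blast
qed

lemma reach_refl: "I \<in> k_independent_sets G k \<Longrightarrow> reach I I"
proof -
  interpret R: pair_graph "reconf_graph G k"
    using pair_graph_G by (rule pair_graph_reconf_graph)
  show "I \<in> k_independent_sets G k \<Longrightarrow> reach I I"
    by (rule R.reachable_refl) (simp add: reconf_graph_def)
qed

lemma reach_slide:
  assumes "insert u K \<in> k_independent_sets G k" "insert v K \<in> k_independent_sets G k"
    and "u \<notin> K" "v \<notin> K" "(u, v) \<in> parcs G"
  shows "reach (insert u K) (insert v K)"
proof -
  interpret R: pair_graph "reconf_graph G k"
    using pair_graph_G by (rule pair_graph_reconf_graph)
  have "u \<noteq> v" using assms(5) by (simp add: arc_iff)
  then have "sym_diff (insert u K) (insert v K) = {u, v}"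
    using assms(3,4) by blast
  then have "(insert u K, insert v K) \<in> parcs (reconf_graph G k)"
    using assms unfolding reconf_graph_def by auto
  then show ?thesis by (intro R.reachable_adjI) simp
qed

text \<open>Shelves are filled from the outside inwards, because the \<open>i\<close>-th long
  interval of a side avoids exactly the shelves of that side numbered below
  \<open>i\<close>.\<close>

definition shelved :: "nat \<Rightarrow> nat \<Rightarrow> nat set" where
  "shelved a b = {X + 2 * p..<X + 2 * p + a} \<union> {X..<X + b}"

lemma shelvedE:
  assumes "v \<in> shelved a b" "a \<le> p" "b \<le> p"
  obtains i where "i < b" "i < p" "v = right_shelf i" | i where "i < a" "i < p" "v = left_shelf i"
proof -
  consider "v \<in> {X..<X + b}" | "v \<in> {X + 2 * p..<X + 2 * p + a}"
    using assms(1) by (auto simp: shelved_def)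
  then show thesis
  proof cases
    case 1
    then show thesis using that(1)[of "v - X"] assms by auto
  next
    case 2
    then show thesis using that(2)[of "v - (X + 2 * p)"] assms by auto
  qed
qed

lemma card_shelved:
  assumes "b \<le> p"
  shows "card (shelved a b) = a + b"
  unfolding shelved_def using assms by (subst card_Un_disjoint) auto

lemma finite_shelved [simp]: "finite (shelved a b)"
  by (simp add: shelved_def)

lemma path_disjoint_shelved: "x < X \<Longrightarrow> x \<notin> shelved a b"
  by (simp add: shelved_def)

lemma shelved_Suc:
  "shelved a (Suc b) = insert (right_shelf b) (shelved a b)"
  "shelved (Suc a) b = insert (left_shelf a) (shelved a b)"
  by (auto simp: shelved_def)

lemma card_path_Un_shelved:
  assumes "A \<subseteq> {..<X}" "b \<le> p"
  shows "card (A \<union> shelved a b) = card A + a + b"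
proof -
  have "A \<inter> shelved a b = {}"
    using assms path_disjoint_shelved by blast
  then have "card (A \<union> shelved a b) = card A + card (shelved a b)"
    using assms(1) finite_subset by (intro card_Un_disjoint) auto
  then show ?thesis using assms(2) card_shelved by simp
qed

lemma path_Un_shelved_separated:
  assumes "A \<subseteq> {..<X}" "\<forall>x\<in>A. Suc x \<notin> A" "a \<le> p" "b \<le> p"
    and "u \<in> A \<union> shelved a b" "v \<in> A \<union> shelved a b" "u \<noteq> v"
  shows "hi u < lo v \<or> hi v < lo u"
proof -
  have mixed: "hi x < lo y \<or> hi y < lo x" if "x \<in> A" "y \<in> shelved a b" for x y
  proof -
    have "x < X" using that assms(1) by auto
    with that(2) assms(3,4) show ?thesis
      by (elim shelvedE) (auto simp: lo_hi)
  qed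
  consider "u \<in> A" "v \<in> A" | "u \<in> A" "v \<in> shelved a b" | "u \<in> shelved a b" "v \<in> A"
    | "u \<in> shelved a b" "v \<in> shelved a b"
    using assms(5,6) by blast
  then show ?thesis
  proof cases
    case 1
    then have "u < X" "v < X" "v \<noteq> Suc u" "u \<noteq> Suc v"
      using assms(1,2) by auto
    then show ?thesis using assms(7) by (simp add: lo_hi) linarith
  next
    case 2
    then show ?thesis using mixed by blast
  next
    case 3
    then show ?thesis using mixed by blast
  next
    case 4
    then show ?thesis
      using assms(3,4,7) by (elim shelvedE) (auto simp: lo_hi)
  qed
qed

lemma path_Un_shelved_independent:
  assumes "A \<subseteq> {..<X}" "\<forall>x\<in>A. Suc x \<notin> A" "a \<le> p" "b \<le> p" "card A + a + b = k"
  shows "A \<union> shelved a b \<in> k_independent_sets G k"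
  unfolding k_independent_iff
proof (intro conjI ballI impI)
  show "A \<union> shelved a b \<subseteq> {..<X + 4 * p}"
    using assms(1,3,4) by (auto simp: shelved_def)
  show "card (A \<union> shelved a b) = k"
    using assms card_path_Un_shelved by simp
qed (rule path_Un_shelved_separated[OF assms(1-4)])

text \<open>Covers the intermediate configurations in which a token sits on the long interval
  \<open>z\<close> on its way to a shelf.\<close>

lemma insert_path_Un_shelved_independent:
  assumes "A \<subseteq> {..<X}" "\<forall>x\<in>A. Suc x \<notin> A" "a \<le> p" "b \<le> p" "Suc (card A + a + b) = k"
    and z: "z < X + 4 * p" and sep: "\<And>v. v \<in> A \<union> shelved a b \<Longrightarrow> hi v < lo z \<or> hi z < lo v"
  shows "insert z (A \<union> shelved a b) \<in> k_independent_sets G k"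
  unfolding k_independent_iff
proof (intro conjI ballI impI)
  show "insert z (A \<union> shelved a b) \<subseteq> {..<X + 4 * p}"
    using assms(1,3,4) z by (auto simp: shelved_def)
  have "z \<notin> A \<union> shelved a b"
    using sep[of z] lo_le_hi[OF z] by auto
  moreover have "finite A"
    using assms(1) finite_subset by blast
  ultimately show "card (insert z (A \<union> shelved a b)) = k"
    using assms(1,4,5) card_path_Un_shelved[of A b a] by simp
next
  fix u v assume "u \<in> insert z (A \<union> shelved a b)" "v \<in> insert z (A \<union> shelved a b)" "u \<noteq> v"
  then show "hi u < lo v \<or> hi v < lo u"
    using sep path_Un_shelved_separated[OF assms(1-4)] by blast
qed

definition low :: "nat \<Rightarrow> nat set" where "low n = (\<lambda>t. 2 * t) ` {..<n}"

definition high :: "nat \<Rightarrow> nat set" where "high n = (\<lambda>t. X - 1 - 2 * t) ` {..<n}"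

lemma low_Suc: "low (Suc n) = insert (2 * n) (low n)"
  by (simp add: low_def lessThan_Suc)

lemma high_Suc: "high (Suc n) = insert (X - 1 - 2 * n) (high n)"
  by (simp add: high_def lessThan_Suc)

lemma low_props:
  assumes "n \<le> k"
  shows "low n \<subseteq> {..<X}" "\<forall>x\<in>low n. Suc x \<notin> low n" "card (low n) = n"
proof -
  show "low n \<subseteq> {..<X}" using assms by (auto simp: low_def X_def)
  show "\<forall>x\<in>low n. Suc x \<notin> low n" unfolding low_def by (clarsimp, presburger)
  show "card (low n) = n" unfolding low_def by (subst card_image) (auto simp: inj_on_def)
qed

lemma high_props:
  assumes "n \<le> k"
  shows "high n \<subseteq> {..<X}" "\<forall>x\<in>high n. Suc x \<notin> high n" "card (high n) = n"
proof -
  \<comment> \<open>Ensures that \<open>X - 1 - 2 * t\<close> is never truncated for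
    \<open>t < n\<close>.\<close>
  have X: "4 * n \<le> X" using assms by (simp add: X_def)
  show "high n \<subseteq> {..<X}" using X by (auto simp: high_def)
  show "\<forall>x\<in>high n. Suc x \<notin> high n"
  proof
    fix x assume "x \<in> high n"
    then obtain t where t: "t < n" "x = X - 1 - 2 * t" by (auto simp: high_def)
    show "Suc x \<notin> high n"
    proof
      assume "Suc x \<in> high n"
      then obtain t' where "t' < n" "Suc x = X - 1 - 2 * t'" by (auto simp: high_def)
      with t X have "2 * t = Suc (2 * t')" by linarith
      then show False by presburger
    qed
  qed
  have "inj_on (\<lambda>t. X - 1 - 2 * t) {..<n}"
  proof (rule inj_onI)
    fix s t assume "s \<in> {..<n}" "t \<in> {..<n}" "X - 1 - 2 * s = X - 1 - 2 * t"
    moreover from this have "s < n" "t < n" by simp_all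
    ultimately show "s = t" using X by linarith
  qed
  then show "card (high n) = n" unfolding high_def by (simp add: card_image)
qed

text \<open>The hypothesis says that no token can slide left: each positive element has an element
  two below it. Descending by 2 can only end at 0, so all elements are even and their halves form an
  initial segment.\<close>

lemma packed_eq_low:
  assumes "finite A" and pred: "\<And>x. Suc x \<in> A \<Longrightarrow> \<exists>y\<in>A. Suc y = x"
  shows "A = low (card A)"
proof -
  have even: "even x" if "x \<in> A" for x
    using that
  proof (induction x rule: less_induct)
    case (less x)
    show ?case
    proof (cases x)
      case (Suc x')
      with less.prems pred obtain y where "y \<in> A" "Suc y = x'" by blast
      with less.IH[of y] Suc show ?thesis by auto
    qed simp
  qed
  define B where "B = {t. 2 * t \<in> A}"
  have A: "A = (\<lambda>t. 2 * t) ` B"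
    using even by (auto simp: B_def elim!: evenE)
  have inj: "inj_on (\<lambda>t. 2 * t) B" for B :: "nat set"
    by (auto simp: inj_on_def)
  have "B = {..<card B}"
  proof (rule finite_downward_closed_nat)
    show "finite B" using assms(1) A finite_imageD inj by metis
    show "n \<in> B" if "Suc n \<in> B" for n
      using that pred[of "Suc (2 * n)"] by (auto simp: B_def)
  qed
  moreover have "card A = card B" using A inj by (metis card_image)
  ultimately show ?thesis using A by (simp add: low_def)
qed

text \<open>Slides path tokens left one at a time. Each slide lowers the sum of the positions, and a
  set without such a slide is packed.\<close>

lemma reach_low:
  assumes "A \<subseteq> {..<X}" "\<forall>x\<in>A. Suc x \<notin> A" "a \<le> p" "b \<le> p" "card A + a + b = k"
  shows "reach (A \<union> shelved a b) (low (card A) \<union> shelved a b)"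
  using assms
proof (induction "\<Sum>A" arbitrary: A rule: less_induct)
  case less
  have fin: "finite A" using less.prems(1) finite_subset by blast
  have ind: "A \<union> shelved a b \<in> k_independent_sets G k"
    using less.prems by (rule path_Un_shelved_independent)
  show ?case
  proof (cases "\<exists>x. Suc x \<in> A \<and> (\<forall>y\<in>A. Suc y \<noteq> x)")
    case True
    then obtain x where x: "Suc x \<in> A" "\<forall>y\<in>A. Suc y \<noteq> x" by blast
    \<comment> \<open>So \<open>x\<close> is free and its left neighbour, if any, is unoccupied: the
      token on \<open>Suc x\<close> may slide to \<open>x\<close>.\<close>
    have "x \<notin> A" using x less.prems(2) by blast
    define K where "K = A - {Suc x}"
    have K: "finite K" "Suc x \<notin> K" "x \<notin> K" "A = insert (Suc x) K"
      using fin x \<open>x \<notin> A\<close> by (auto simp: K_def)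
    have "\<Sum>(insert x K) < \<Sum>A" using K by simp
    moreover have sub: "insert x K \<subseteq> {..<X}" using less.prems(1) K x by auto
    moreover have sp: "\<forall>y\<in>insert x K. Suc y \<notin> insert x K"
      using less.prems(2) K x by auto
    moreover have card: "card (insert x K) = card A" using K by simp
    ultimately have "reach (insert x K \<union> shelved a b) (low (card A) \<union> shelved a b)"
      using less.hyps[of "insert x K"] less.prems by simp
    moreover have "reach (insert (Suc x) (K \<union> shelved a b)) (insert x (K \<union> shelved a b))"
    proof (rule reach_slide)
      show "insert (Suc x) (K \<union> shelved a b) \<in> k_independent_sets G k"
        using ind K by simp
      show "insert x (K \<union> shelved a b) \<in> k_independent_sets G k"
        using path_Un_shelved_independent[OF sub sp] less.prems card by simp
      have "Suc x < X" using less.prems(1) x by auto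
      then show "Suc x \<notin> K \<union> shelved a b" "x \<notin> K \<union> shelved a b" "(Suc x, x) \<in> parcs G"
        using K path_disjoint_shelved by (auto simp: arc_iff lo_hi)
    qed
    moreover have "A \<union> shelved a b = insert (Suc x) (K \<union> shelved a b)"
      "insert x K \<union> shelved a b = insert x (K \<union> shelved a b)"
      using K by simp_all
    ultimately show ?thesis using reach_trans by metis
  next
    case False
    then have "A = low (card A)" by (intro packed_eq_low[OF fin]) blast
    with reach_refl[OF ind] show ?thesis by metis
  qed
qed

text \<open>Slides are reversible, so it suffices that the right packing can be slid to the left
  packing, an instance of \<open>reach_low\<close>.\<close>

lemma reach_low_high:
  assumes "a \<le> p" "b \<le> p" "n + a + b = k"
  shows "reach (low n \<union> shelved a b) (high n \<union> shelved a b)"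
proof -
  have "n \<le> k" using assms by simp
  note high = high_props[OF this]
  have "reach (high n \<union> shelved a b) (low (card (high n)) \<union> shelved a b)"
    using high assms by (intro reach_low) simp_all
  then show ?thesis unfolding high(3) by (rule reach_sym)
qed

text \<open>The count \<open>Suc n + j + j = k\<close> puts the left end of the \<open>j\<close>-th
  right long interval at \<open>2 * n\<close>: it meets the last packed token but not the one
  before. Its right end is the point of the next free right shelf.\<close>

lemma reach_right_shelf:
  assumes "j < p" "Suc n + j + j = k"
  shows "reach (low (Suc n) \<union> shelved j j) (low n \<union> shelved j (Suc j))"
proof -
  let ?K = "low n \<union> shelved j j"
  have n: "Suc n \<le> k" "n \<le> k" using assms by auto
  note low = low_props[OF n(1)] low_props[OF n(2)]
  have K: "low (Suc n) \<union> shelved j j = insert (2 * n) ?K"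
    "low n \<union> shelved j (Suc j) = insert (right_shelf j) ?K"
    by (auto simp: low_Suc shelved_Suc)
  have X: "2 * n < X" using n by (simp add: X_def)
  have first: "insert (2 * n) ?K \<in> k_independent_sets G k"
    using path_Un_shelved_independent[of "low (Suc n)" j j] low assms by (simp add: K)
  have last: "insert (right_shelf j) ?K \<in> k_independent_sets G k"
    using path_Un_shelved_independent[of "low n" j "Suc j"] low assms by (simp add: K)
  have sep: "hi v < lo (right_long j) \<or> hi (right_long j) < lo v" if "v \<in> ?K" for v
  proof -
    consider "v \<in> low n" | "v \<in> shelved j j" using \<open>v \<in> ?K\<close> by blast
    then show ?thesis
    proof cases
      case 1
      then obtain t where "t < n" "v = 2 * t" by (auto simp: low_def)
      then show ?thesis using assms X by (simp add: lo_hi)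
    next
      case 2
      then show ?thesis using assms by (elim shelvedE) (auto simp: lo_hi)
    qed
  qed
  have mid: "insert (right_long j) ?K \<in> k_independent_sets G k"
    using low assms sep by (intro insert_path_Un_shelved_independent) auto
  have notin: "2 * n \<notin> ?K" "right_long j \<notin> ?K" "right_shelf j \<notin> ?K"
    using low(1) X assms by (auto simp: low_def shelved_def X_def)
  have "reach (insert (2 * n) ?K) (insert (right_long j) ?K)"
    using first mid notin X assms by (intro reach_slide) (simp_all add: arc_iff lo_hi)
  moreover have "reach (insert (right_long j) ?K) (insert (right_shelf j) ?K)"
    using last mid notin X assms by (intro reach_slide) (simp_all add: arc_iff lo_hi)
  ultimately show ?thesis unfolding K by (rule reach_trans)
qed

text \<open>Here the extra token shelved on the right puts the right end of the \<open>j\<close>-th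
  left long interval at \<open>X - 2 * n\<close>, where it touches only the innermost packed token,
  the one at \<open>X - 1 - 2 * n\<close>.\<close>

lemma reach_left_shelf:
  assumes "j < p" "Suc n + j + Suc j = k"
  shows "reach (high (Suc n) \<union> shelved j (Suc j)) (high n \<union> shelved (Suc j) (Suc j))"
proof -
  let ?K = "high n \<union> shelved j (Suc j)"
  have n: "Suc n \<le> k" "n \<le> k" using assms by auto
  define x where "x = X - 1 - 2 * n"
  note high = high_props[OF n(1)] high_props[OF n(2)]
  have K: "high (Suc n) \<union> shelved j (Suc j) = insert x ?K"
    "high n \<union> shelved (Suc j) (Suc j) = insert (left_shelf j) ?K"
    by (auto simp: high_Suc shelved_Suc x_def)
  have X: "x < X" "int x = int X - 1 - 2 * int n" "4 * n < X"
    using n by (simp_all add: x_def X_def)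
  have first: "insert x ?K \<in> k_independent_sets G k"
    using path_Un_shelved_independent[of "high (Suc n)" j "Suc j"] high assms by (simp add: K)
  have last: "insert (left_shelf j) ?K \<in> k_independent_sets G k"
    using path_Un_shelved_independent[of "high n" "Suc j" "Suc j"] high assms by (simp add: K)
  have sep: "hi v < lo (left_long j) \<or> hi (left_long j) < lo v" if "v \<in> ?K" for v
  proof -
    consider "v \<in> high n" | "v \<in> shelved j (Suc j)" using \<open>v \<in> ?K\<close> by blast
    then show ?thesis
    proof cases
      case 1
      then obtain t where t: "t < n" "v = X - 1 - 2 * t" by (auto simp: high_def)
      then have "v < X" "int v = int X - 1 - 2 * int t" using X(3) by auto
      then show ?thesis using assms t(1) by (simp add: lo_hi)
    next
      case 2
      then show ?thesis using assms by (elim shelvedE) (auto simp: lo_hi)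
    qed
  qed
  have mid: "insert (left_long j) ?K \<in> k_independent_sets G k"
    using high assms sep by (intro insert_path_Un_shelved_independent) auto
  have notin: "x \<notin> ?K" "left_long j \<notin> ?K" "left_shelf j \<notin> ?K"
    using high(4) X(1,3) assms by (auto simp: high_def shelved_def x_def)
  have n_int: "int n = int k - 2 * int j - 2" "4 * int n < int X"
    using assms X(3) by linarith+
  then have "lo x \<le> hi (left_long j)" "lo (left_long j) \<le> hi x"
    using X(2) assms(1) unfolding lo_hi_path[OF X(1)] lo_hi_left_long[OF assms(1)] by simp_all
  then have "(x, left_long j) \<in> parcs G"
    using X(1) assms(1) by (simp add: arc_iff)
  with first mid notin have "reach (insert x ?K) (insert (left_long j) ?K)"
    by (intro reach_slide)
  moreover have "reach (insert (left_long j) ?K) (insert (left_shelf j) ?K)"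
    using last mid notin X(3) assms shelves_le
    by (intro reach_slide) (simp_all add: arc_iff lo_hi X_int)
  ultimately show ?thesis unfolding K by (rule reach_trans)
qed

text \<open>One induction step is a full round: shelve on the right, traverse to the right, shelve
  on the left, traverse back to the left.\<close>

lemma reach_shelved:
  "j \<le> p \<Longrightarrow> reach (high k \<union> shelved 0 0) (low (k - 2 * j) \<union> shelved j j)"
proof (induction j)
  case 0
  then show ?case using reach_sym[OF reach_low_high[of 0 0 k]] by simp
next
  case (Suc j)
  define n where "n = k - 2 * Suc j"
  have n: "k = Suc (Suc n) + j + j" "k - 2 * j = Suc (Suc n)" "k - 2 * Suc j = n"
    using Suc.prems shelves_le by (auto simp: n_def)
  have "reach (high k \<union> shelved 0 0) (low (Suc (Suc n)) \<union> shelved j j)"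
    using Suc n by simp
  also have "reach \<dots> (low (Suc n) \<union> shelved j (Suc j))"
    using Suc.prems n(1) by (intro reach_right_shelf) auto
  also have "reach \<dots> (high (Suc n) \<union> shelved j (Suc j))"
    using Suc.prems n(1) by (intro reach_low_high) auto
  also have "reach \<dots> (high n \<union> shelved (Suc j) (Suc j))"
    using Suc.prems n(1) by (intro reach_left_shelf) auto
  also have "reach \<dots> (low n \<union> shelved (Suc j) (Suc j))"
    using Suc.prems n(1) by (intro reach_sym[OF reach_low_high]) auto
  finally show ?case unfolding n(3) .
qed

section \<open>Potential of the end configurations and the resulting bound\<close>

lemma start_independent: "high k \<union> shelved 0 0 \<in> k_independent_sets G k"
  using high_props[of k] by (intro path_Un_shelved_independent) auto

lemma end_independent: "low (k - 2 * p) \<union> shelved p p \<in> k_independent_sets G k"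
  using low_props[of "k - 2 * p"] shelves_le by (intro path_Un_shelved_independent) auto

text \<open>No token is shelved and all are packed at the right end, so the first traversal, to the
  left, has not begun.\<close>

lemma potential_start: "potential (high k \<union> shelved 0 0) = 0"
proof -
  have "progress x = int m" if "x \<in> high k" for x
    using that by (auto simp: high_def progress_def X_def)
  moreover have "high k \<union> shelved 0 0 = high k" by (simp add: shelved_def)
  moreover have "high k \<inter> {X..<X + p} = {}" "high k \<inter> {X + 2 * p..<X + 3 * p} = {}"
    using high_props(1)[of k] by auto
  ultimately show ?thesis
    using width_nonneg by (simp add: potential_def lam_def rho_def remaining_def)
qed

text \<open>All \<open>2 * p\<close> shelvings are done, and the \<open>k - 2 * p\<close> tokens
  left have completed the last leftward traversal, so \<open>remaining\<close> is exactly
  \<open>width\<close>.\<close>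

lemma potential_end: "potential (low (k - 2 * p) \<union> shelved p p) = (2 * int p + 1) * width"
proof -
  have low: "low (k - 2 * p) \<subseteq> {..<X}" "card (low (k - 2 * p)) = k - 2 * p"
    using low_props[of "k - 2 * p"] by simp_all
  then have "(low (k - 2 * p) \<union> shelved p p) \<inter> {X..<X + p} = {X..<X + p}"
    "(low (k - 2 * p) \<union> shelved p p) \<inter> {X + 2 * p..<X + 3 * p} = {X + 2 * p..<X + 3 * p}"
    "(low (k - 2 * p) \<union> shelved p p) \<inter> {..<X} = low (k - 2 * p)"
    by (auto simp: shelved_def)
  moreover have "progress x = 0" if "x \<in> low (k - 2 * p)" for x
    using that by (auto simp: low_def progress_def)
  ultimately show ?thesis
    using low(2) by (simp add: potential_def lam_def rho_def remaining_def width_def ring_distribs)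
qed

lemma long_reconfiguration:
  "\<exists>(G :: nat pair_pre_digraph) I J. interval_graph G \<and> card (pverts G) = m + 4 * k + 4 * p \<and>
     I \<in> k_independent_sets G k \<and> J \<in> k_independent_sets G k \<and> reconfigurable G k I J \<and>
     (\<forall>s. reconf_seq G k I J s \<longrightarrow> (2 * p + 1) * ((k - 2 * p) * m) \<le> length s)"
proof (intro exI conjI allI impI)
  show "card (pverts G) = m + 4 * k + 4 * p" by (simp add: G_def X_def)
  show "reconfigurable G k (high k \<union> shelved 0 0) (low (k - 2 * p) \<union> shelved p p)"
    using reach_shelved[of p] reconfigurable_iff_reachable[OF pair_graph_G] by simp
  fix s assume "reconf_seq G k (high k \<union> shelved 0 0) (low (k - 2 * p) \<union> shelved p p) s"
  from length_reconf_seq_ge[OF this] have "int ((2 * p + 1) * ((k - 2 * p) * m)) \<le> int (length s)"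
    by (simp add: potential_start potential_end width_def ring_distribs)
  then show "(2 * p + 1) * ((k - 2 * p) * m) \<le> length s" by linarith
qed (rule interval_graph_G start_independent end_independent)+

end

theorem theorem2:
  shows "\<exists>c1 c2 :: real. c1 > 0 \<and> c2 > 0 \<and>
    (\<forall>m k :: nat. m \<ge> 1 \<longrightarrow> k \<ge> 1 \<longrightarrow>
      (\<exists>(G :: nat pair_pre_digraph) I J.
         interval_graph G \<and>
         real (card (pverts G)) \<le> c1 * (real m + real k) \<and>
         I \<in> k_independent_sets G k \<and> J \<in> k_independent_sets G k \<and>
         reconfigurable G k I J \<and>
         (\<forall>s. reconf_seq G k I J s \<longrightarrow> c2 * (real k)\<^sup>2 * real m \<le> real (length s))))"
proof (rule exI[of _ 6], rule exI[of _ "1 / 9"], intro conjI allI impI)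
  show "(6 :: real) > 0" "(1 / 9 :: real) > 0" by simp_all
  fix m k :: nat
  \<comment> \<open>With this choice both the number \<open>2 * p + 1\<close> of traversals and the
    number \<open>k - 2 * p\<close> of tokens in each are at least \<open>k / 3\<close>, whence the
    constant 1/9. The vertex count \<open>m + 4 * k + 4 * p\<close> is at most
    \<open>m + 16 * k / 3\<close>, whence the constant 6.\<close>
  define p where "p = k div 3"
  interpret shelf_graph m k p
    by standard (simp add: p_def)
  obtain G :: "nat pair_pre_digraph" and I J where
    G: "interval_graph G" "card (pverts G) = m + 4 * k + 4 * p"
    and IJ: "I \<in> k_independent_sets G k" "J \<in> k_independent_sets G k" "reconfigurable G k I J"
    and len: "\<forall>s. reconf_seq G k I J s \<longrightarrow> (2 * p + 1) * ((k - 2 * p) * m) \<le> length s"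
    using long_reconfiguration by blast
  have "k * k \<le> 9 * ((2 * p + 1) * (k - 2 * p))"
  proof -
    have "k \<le> 3 * (2 * p + 1)" unfolding p_def by presburger
    moreover have "k \<le> 3 * (k - 2 * p)" unfolding p_def by presburger
    ultimately have "k * k \<le> (3 * (2 * p + 1)) * (3 * (k - 2 * p))" by (rule mult_le_mono)
    then show ?thesis by (simp only: mult_ac)
  qed
  then have "k * k * m \<le> 9 * ((2 * p + 1) * ((k - 2 * p) * m))"
    by (simp only: mult_le_mono1 flip: mult.assoc)
  then have "1 / 9 * (real k)\<^sup>2 * real m \<le> real (length s)" if "reconf_seq G k I J s" for s
  proof -
    have "k * k * m \<le> 9 * length s"
      using \<open>k * k * m \<le> _\<close> len that by (meson le_trans mult_le_mono2)
    then have "real (k * k * m) \<le> real (9 * length s)" by (rule of_nat_mono)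
    then show ?thesis by (simp add: power2_eq_square)
  qed
  moreover have "real (card (pverts G)) \<le> 6 * (real m + real k)"
    using G(2) by (simp add: p_def)
  ultimately show "\<exists>(G :: nat pair_pre_digraph) I J.
         interval_graph G \<and>
         real (card (pverts G)) \<le> 6 * (real m + real k) \<and>
         I \<in> k_independent_sets G k \<and> J \<in> k_independent_sets G k \<and>
         reconfigurable G k I J \<and>
         (\<forall>s. reconf_seq G k I J s \<longrightarrow> 1 / 9 * (real k)\<^sup>2 * real m \<le> real (length s))"
    using G(1) IJ by blast
qed

end
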